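(* Let $\mathcal L\to\mathbb C^\times\times M_+$ be the line bundle (with cover $\{U_k^\pm\}_{k\in\mathbb Z}$, sections $\widehat Z_{\pm\rho_k}$ and functions $f_{\pm\rho_k}$) described in the context. In terms of the local trivializations of $\mathcal L$ given by $$\exp\Big(\frac{\mathrm i}{4\pi}f_{\pm\rho_k}\mp\frac{\mathrm i\pi}{24}\Big)\widehat Z_{\pm\rho_k}\quad\text{on }U_k^\pm,$$ the transition functions of $\mathcal L$ are: (1) if $U_{k_1}^\pm\cap U_{k_2}^\pm\neq\emptyset$ with $k_1<k_2$, $$\widetilde g^\pm_{k_1,k_2}=\prod_{k_1\le k<k_2}\exp\Big(\frac{\Omega(\beta+k\delta)}{2\pi \mathrm i}L(\mathcal X_{\pm(\beta+k\delta)})\Big);$$ (2) if $U_{k_1}^+\cap U_{k_2}^-\ne\emptyset$ and $\mathcal L_\infty\subset[\rho_{k_1},-\rho_{k_2}]$, $$\widetilde g^\infty_{k_1,k_2}=\prod_{k\ge k_1}\exp\Big(\frac{\Omega(\beta+k\delta)}{2\pi \mathrm i}L(\mathcal X_{\beta+k\delta})\Big)\prod_{k<k_2}\exp\Big(\frac{\Omega(\beta+k\delta)}{2\pi \mathrm i}L(\mathcal X_{-(\beta+k\delta)})\Big)\prod_{k\ge1}\exp\Big(\frac{\Omega(k\delta)}{2\pi \mathrm i}L(\mathcal X_{k\delta})\Big),$$ and analogously, if $-\mathcal L_\infty\subset[\rho_{k_1},-\rho_{k_2}]$, $$\widetilde g^{-\infty}_{k_2,k_1}=\prod_{k\ge k_2}\exp\Big(\frac{\Omega(\beta+k\delta)}{2\pi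 \mathrm i}L(\mathcal X_{-(\beta+k\delta)})\Big)\prod_{k<k_1}\exp\Big(\frac{\Omega(\beta+k\delta)}{2\pi \mathrm i}L(\mathcal X_{\beta+k\delta})\Big)\prod_{k\ge1}\exp\Big(\frac{\Omega(k\delta)}{2\pi \mathrm i}L(\mathcal X_{-k\delta})\Big).$$ In particular, the constant factors $e^{\mp \mathrm i\pi/12}$ occurring in the original transition functions $g^{\pm\infty}$ are removed.
   Context: **Basic data.** $M=\{(v,w)\in\mathbb C^2:w\ne0,\ v+nw\ne0\ \forall n\in\mathbb Z\}$, $M_+=\{(v,w)\in M:\mathrm{Im}(v/w)>0\}$, $\mathcal L_k=\mathbb R_{<0}\cdot2\pi \mathrm i(v+kw)$, $\mathcal L_\infty=\mathbb R_{<0}\cdot2\pi \mathrm i w$; $\rho_k$ is the middle ray of the sector between $\mathcal L_k$ and $\mathcal L_{k-1}$; $\mathbb H_\rho$ is the open half-plane centered at $\rho$; $U_k^\pm=\{(\lambda_{\mathrm B},v,w)\in\mathbb C^\times\times M_+:\lambda_{\mathrm B}\in\mathbb H_{\pm\rho_k}\}$; $[\rho_{k_1},-\rho_{k_2}]$ is the smaller of the two sectors bounded by $\rho_{k_1}$ and $-\rho_{k_2}$. BPS indices $\Omega(\pm\beta+n\delta)=1$, $\Omega(k\delta)=-2$ ($k\ne0$). $\mathcal X_{n\beta+m\delta}=e^{2\pi \mathrm i(nv+mw)/\lambda_{\mathrm B}}$ with $\log\mathcal X_{n\beta+m\delta}:=2\pi \mathrm i(nv+mw)/\lambda_{\mathrm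 B}$. Rogers dilogarithm: $L(x)=\mathrm{Li}_2(x)+\frac12\log(x)\log(1-x)$, evaluated on $\mathcal X_\gamma$ with this $\log\mathcal X_\gamma$ and principal $\mathrm{Li}_2(\mathcal X_\gamma),\log(1-\mathcal X_\gamma)$ (all $|\mathcal X_\gamma|<1$ on the relevant overlaps). **The line bundle.** $\mathcal L\to\mathbb C^\times\times M_+$ is the line bundle whose transition functions for the cover $\{U_k^\pm\}$ are as follows, with $\Xi_{\pm\mathcal L_k}=\exp(\frac{1}{2\pi \mathrm i}\partial_{\lambda_{\mathrm B}}(\lambda_{\mathrm B}\mathrm{Li}_2(\mathcal X_{\pm(\beta+k\delta)})))$, $\Xi_{\pm\mathcal L_\infty,k}=\exp(-\frac1{\pi \mathrm i}\partial_{\lambda_{\mathrm B}}(\lambda_{\mathrm B}\mathrm{Li}_2(\mathcal X_{\pm k\delta})))$: from $U_{k_1}^\pm$ to $U_{k_2}^\pm$ ($k_1<k_2$), $g^\pm_{k_1,k_2}=\prod_{k_1\le k<k_2}\Xi_{\pm\mathcal L_k}$; from $U_{k_1}^+$ to $U_{k_2}^-$ if $\mathcal L_\infty\subset[\rho_{k_1},-\rho_{k_2}]$, $g^\infty_{k_1,k_2}=e^{-\pi \mathrm i/12}\prod_{k\ge k_1}\Xi_{\mathcal L_k}\prod_{k<k_2}\Xi_{-\mathcal L_k}\prod_{k\ge1}\Xi_{\mathcal L_\infty,k}$; from $U_{k_2}^-$ to $U_{k_1}^+$ if $-\mathcal L_\infty\subset[\rho_{k_1},-\rho_{k_2}]$,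 $g^{-\infty}_{k_2,k_1}=e^{\pi \mathrm i/12}\prod_{k\ge k_2}\Xi_{-\mathcal L_k}\prod_{k<k_1}\Xi_{\mathcal L_k}\prod_{k\ge1}\Xi_{-\mathcal L_\infty,k}$. A transition function $g$ from $U$ to $U'$ means that local frames are related by $s_{U'}=g\,s_U$. The frames giving these transition functions are the nowhere vanishing functions $\widehat Z_{\pm\rho_k}(\lambda_{\mathrm B},v,w)$ (normalized Borel-summed topological string partition functions), i.e. $\widehat Z_{\pm\rho_{k_2}}=g^\pm_{k_1,k_2}\widehat Z_{\pm\rho_{k_1}}$, $\widehat Z_{-\rho_{k_2}}=g^\infty_{k_1,k_2}\widehat Z_{\rho_{k_1}}$, $\widehat Z_{\rho_{k_1}}=g^{-\infty}_{k_2,k_1}\widehat Z_{-\rho_{k_2}}$ on the respective overlaps. **The functions $f$.** Let $\mathcal X_{\beta^\vee,\pm\rho_k},\mathcal X_{\delta^\vee,\pm\rho_k}$ be the (unique) solution of Bridgeland's Riemann--Hilbert problem for the resolved conifold: nowhere vanishing holomorphic functions of $\lambda_{\mathrm B}\in\mathbb H_{\pm\rho_k}$, tending to $1$ as $\lambda_{\mathrm B}\to0$, of polynomial growth (together with their inverses) as $\lambda_{\mathrm B}\to\infty$, with jumps given by the exponentials of the relations below. Choose logarithms $x_{\beta^\vee,\pm\rho_k}=\log\mathcal X_{\beta^\vee,\pm\rho_k}$, $x_{\delta^\vee,\pm\rho_k}=\log\mathcal X_{\delta^\vee,\pm\rho_k}$ such that, on common domains (such choices exist): - $x_{\beta^\vee,\pm\rho_{k+1}}=x_{\beta^\vee,\pm\rho_k}\pm\log(1-\mathcal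 X_{\pm(\beta+k\delta)})$ and $x_{\delta^\vee,\pm\rho_{k+1}}=x_{\delta^\vee,\pm\rho_k}\pm k\log(1-\mathcal X_{\pm(\beta+k\delta)})$; - if $\mathcal L_\infty\subset[\rho_{k_1},-\rho_{k_2}]$: $x_{\beta^\vee,-\rho_{k_2}}=x_{\beta^\vee,\rho_{k_1}}+\sum_{k\ge k_1}\log(1-\mathcal X_{\beta+k\delta})-\sum_{k>-k_2}\log(1-\mathcal X_{-\beta+k\delta})$ and $x_{\delta^\vee,-\rho_{k_2}}=x_{\delta^\vee,\rho_{k_1}}+\sum_{k\ge k_1}k\log(1-\mathcal X_{\beta+k\delta})+\sum_{k>-k_2}k\log(1-\mathcal X_{-\beta+k\delta})-\sum_{k\ge1}2k\log(1-\mathcal X_{k\delta})$; - if $-\mathcal L_\infty\subset[\rho_{k_1},-\rho_{k_2}]$: $x_{\beta^\vee,\rho_{k_1}}=x_{\beta^\vee,-\rho_{k_2}}-\sum_{k\ge k_2}\log(1-\mathcal X_{-\beta-k\delta})+\sum_{k>-k_1}\log(1-\mathcal X_{\beta-k\delta})$ and $x_{\delta^\vee,\rho_{k_1}}=x_{\delta^\vee,-\rho_{k_2}}-\sum_{k\ge k_2}k\log(1-\mathcal X_{-\beta-k\delta})-\sum_{k>-k_1}k\log(1-\mathcal X_{\beta-k\delta})+\sum_{k\ge1}2k\log(1-\mathcal X_{-k\delta})$. Then $f_{\pm\rho_k}=\frac{2\pi \mathrm i v}{\lambda_{\mathrm B}}x_{\beta^\vee,\pm\rho_k}+\frac{2\pi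 \mathrm i w}{\lambda_{\mathrm B}}x_{\delta^\vee,\pm\rho_k}$.
   Formalization: That the rescaled sections are local trivializations is stated for those U_k^± on which f_{±ρ_k} is continuous, since the logarithms could otherwise be chosen discontinuously in (v,w); the transition function formulas need no such condition. *)

theory Defs
  imports "HOL-Analysis.Analysis"
begin

section \<open>Complex line bundles, frames and transition functions\<close>

text \<open>
  A bundle is given by its total space \<open>E\<close> (an abstract topology), its projection \<open>pr\<close> to the base
  \<open>B\<close>, and its fibrewise addition \<open>add\<close> and scalar multiplication \<open>scl\<close>.  Only sums of points in
  the same fibre are meaningful.  A local trivialization identifies each fibre with the vector space
  \<open>\<complex>\<close>, so the vector space axioms in the fibres need not be stated separately.
\<close>

definition local_trivialization ::
  "'b::topological_space set \<Rightarrow> 'e topology \<Rightarrow> ('e \<Rightarrow> 'b) \<Rightarrow> ('e \<Rightarrow> 'e \<Rightarrow> 'e) \<Rightarrow> (complex \<Rightarrow> 'e \<Rightarrow> 'e)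
     \<Rightarrow> 'b set \<Rightarrow> ('b \<times> complex \<Rightarrow> 'e) \<Rightarrow> bool"
  where
  "local_trivialization B E pr add scl U \<phi> \<longleftrightarrow>
     openin (top_of_set B) U \<and>
     homeomorphic_map (prod_topology (top_of_set U) (euclidean :: complex topology))
       (subtopology E (pr -` U)) \<phi> \<and>
     (\<forall>p\<in>U. \<forall>a b.
        pr (\<phi> (p, a)) = p \<and>
        add (\<phi> (p, a)) (\<phi> (p, b)) = \<phi> (p, a + b) \<and>
        scl a (\<phi> (p, b)) = \<phi> (p, a * b))"

definition complex_line_bundle ::
  "'b::topological_space set \<Rightarrow> 'e topology \<Rightarrow> ('e \<Rightarrow> 'b) \<Rightarrow> ('e \<Rightarrow> 'e \<Rightarrow> 'e) \<Rightarrow> (complex \<Rightarrow> 'e \<Rightarrow> 'e) \<Rightarrow> bool"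
  where
  "complex_line_bundle B E pr add scl \<longleftrightarrow>
     continuous_map E (top_of_set B) pr \<and>
     (\<forall>p\<in>B. \<exists>U \<phi>. p \<in> U \<and> local_trivialization B E pr add scl U \<phi>)"

text \<open>A local frame over \<open>U\<close> is a section whose multiples trivialize the bundle over \<open>U\<close>.\<close>

definition local_frame ::
  "'b::topological_space set \<Rightarrow> 'e topology \<Rightarrow> ('e \<Rightarrow> 'b) \<Rightarrow> ('e \<Rightarrow> 'e \<Rightarrow> 'e) \<Rightarrow> (complex \<Rightarrow> 'e \<Rightarrow> 'e)
     \<Rightarrow> 'b set \<Rightarrow> ('b \<Rightarrow> 'e) \<Rightarrow> bool"
  where
  "local_frame B E pr add scl U s \<longleftrightarrow>
     (\<forall>p\<in>U. s p \<in> topspace E \<and> pr (s p) = p) \<and>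
     local_trivialization B E pr add scl U (\<lambda>(p, z). scl z (s p))"

text \<open>Over \<open>W\<close>, the transition function from the frame \<open>s\<close> to the frame \<open>s'\<close> is \<open>g\<close>: \<open>s' = g s\<close>.\<close>

definition transition_function ::
  "(complex \<Rightarrow> 'e \<Rightarrow> 'e) \<Rightarrow> 'b set \<Rightarrow> ('b \<Rightarrow> 'e) \<Rightarrow> ('b \<Rightarrow> 'e) \<Rightarrow> ('b \<Rightarrow> complex) \<Rightarrow> bool"
  where
  "transition_function scl W s s' g \<longleftrightarrow> (\<forall>p\<in>W. s' p = scl (g p) (s p))"


section \<open>Charges, rays and the cover\<close>

datatype sign = Plus | Minus

fun pm :: "sign \<Rightarrow> 'a::uminus \<Rightarrow> 'a"
  where
  "pm Plus x = x"
| "pm Minus x = - x"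

text \<open>The pair \<open>(n, m)\<close> stands for the charge \<open>n\<beta> + m\<delta>\<close>.\<close>

type_synonym charge = "int \<times> int"

definition BPS :: "charge \<Rightarrow> int"
  where
  "BPS = (\<lambda>(n, m). if n = 1 \<or> n = - 1 then 1 else if n = 0 \<and> m \<noteq> 0 then - 2 else 0)"

definition M_conifold :: "(complex \<times> complex) set"
  where "M_conifold = {(v, w). w \<noteq> 0 \<and> (\<forall>n::int. v + of_int n * w \<noteq> 0)}"

definition M_plus :: "(complex \<times> complex) set"
  where "M_plus = {(v, w). (v, w) \<in> M_conifold \<and> Im (v / w) > 0}"

text \<open>Points of the base are triples \<open>(\<lambda>\<^sub>B, v, w)\<close>.\<close>

type_synonym point = "complex \<times> complex \<times> complex"

definition base_space :: "point set"
  where "base_space = {(l, v, w). l \<noteq> 0 \<and> (v, w) \<in> M_plus}"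

definition neg_ray :: "complex \<Rightarrow> complex set"
  where "neg_ray z = {of_real t * z | t. t < 0}"

definition L_ray :: "int \<Rightarrow> complex \<Rightarrow> complex \<Rightarrow> complex set"
  where "L_ray k v w = neg_ray (2 * of_real pi * \<i> * (v + of_int k * w))"

definition L_inf :: "complex \<Rightarrow> complex set"
  where "L_inf w = neg_ray (2 * of_real pi * \<i> * w)"

text \<open>
  For two non-opposite rays starting at 0, sums of equally long vectors form the ray bisecting
  the smaller sector between them.
\<close>

definition middle_ray :: "complex set \<Rightarrow> complex set \<Rightarrow> complex set"
  where "middle_ray R R' = {a + b | a b. a \<in> R \<and> b \<in> R' \<and> cmod a = cmod b}"

definition rho :: "int \<Rightarrow> complex \<Rightarrow> complex \<Rightarrow> complex set"
  where "rho k v w = middle_ray (L_ray k v w) (L_ray (k - 1) v w)"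

definition signed_ray :: "sign \<Rightarrow> complex set \<Rightarrow> complex set"
  where "signed_ray s R = pm s ` R"

definition half_plane :: "complex set \<Rightarrow> complex set"
  where "half_plane R = {u * z | u z. u \<in> R \<and> Re z > 0}"

text \<open>
  For two non-opposite rays starting at 0, the smaller (closed) sector bounded by them is their
  convex hull.  Opposite rays have disjoint half-planes, so they play no role below.
\<close>

definition smaller_sector :: "complex set \<Rightarrow> complex set \<Rightarrow> complex set"
  where "smaller_sector R R' = convex hull (R \<union> R')"

definition cover :: "sign \<Rightarrow> int \<Rightarrow> point set"
  where "cover s k = {(l, v, w). l \<noteq> 0 \<and> (v, w) \<in> M_plus \<and> l \<in> half_plane (signed_ray s (rho k v w))}"

text \<open>
  The overlap of \<open>U\<^sub>k\<^sub>1\<^sup>+\<close> and \<open>U\<^sub>k\<^sub>2\<^sup>-\<close> where \<open>\<plusminus>\<L>\<^sub>\<infinity>\<close> lies in the sector \<open>[\<rho>\<^sub>k\<^sub>1, -\<rho>\<^sub>k\<^sub>2]\<close>.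
\<close>

definition overlap_inf :: "sign \<Rightarrow> int \<Rightarrow> int \<Rightarrow> point set"
  where "overlap_inf s k1 k2 =
    {(l, v, w). (l, v, w) \<in> cover Plus k1 \<inter> cover Minus k2 \<and>
       signed_ray s (L_inf w) \<subseteq> smaller_sector (rho k1 v w) (signed_ray Minus (rho k2 v w))}"


section \<open>Dilogarithms and the original transition functions\<close>

definition logX :: "charge \<Rightarrow> point \<Rightarrow> complex"
  where "logX = (\<lambda>(n, m) (l, v, w). 2 * of_real pi * \<i> * (of_int n * v + of_int m * w) / l)"

definition X_charge :: "charge \<Rightarrow> point \<Rightarrow> complex"
  where "X_charge \<gamma> p = exp (logX \<gamma> p)"

text \<open>The principal dilogarithm on the unit disc, the only place where it is evaluated below.\<close>

definition Li2 :: "complex \<Rightarrow> complex"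
  where "Li2 z = (\<Sum>n. z ^ Suc n / (of_nat (Suc n))\<^sup>2)"

definition Rogers :: "charge \<Rightarrow> point \<Rightarrow> complex"
  where "Rogers \<gamma> p = Li2 (X_charge \<gamma> p) + 1 / 2 * logX \<gamma> p * Ln (1 - X_charge \<gamma> p)"

definition sum_from :: "int \<Rightarrow> (int \<Rightarrow> complex) \<Rightarrow> complex"
  where "sum_from k0 F = (\<Sum>j. F (k0 + int j))"

definition prod_from :: "int \<Rightarrow> (int \<Rightarrow> complex) \<Rightarrow> complex"
  where "prod_from k0 F = (\<Prod>j. F (k0 + int j))"

definition prod_below :: "int \<Rightarrow> (int \<Rightarrow> complex) \<Rightarrow> complex"
  where "prod_below k0 F = (\<Prod>j. F (k0 - 1 - int j))"

definition d_lambda_Li2 :: "charge \<Rightarrow> point \<Rightarrow> complex"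
  where "d_lambda_Li2 \<gamma> = (\<lambda>(l, v, w). deriv (\<lambda>l'. l' * Li2 (X_charge \<gamma> (l', v, w))) l)"

definition Xi :: "sign \<Rightarrow> int \<Rightarrow> point \<Rightarrow> complex"
  where "Xi s k p = exp (1 / (2 * of_real pi * \<i>) * d_lambda_Li2 (pm s (1, k)) p)"

definition Xi_inf :: "sign \<Rightarrow> int \<Rightarrow> point \<Rightarrow> complex"
  where "Xi_inf s k p = exp (- (1 / (of_real pi * \<i>)) * d_lambda_Li2 (pm s (0, k)) p)"

definition g_sec :: "sign \<Rightarrow> int \<Rightarrow> int \<Rightarrow> point \<Rightarrow> complex"
  where "g_sec s k1 k2 p = (\<Prod>k\<in>{k1..<k2}. Xi s k p)"

definition g_inf :: "int \<Rightarrow> int \<Rightarrow> point \<Rightarrow> complex"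
  where "g_inf k1 k2 p =
    exp (- (of_real pi * \<i> / 12))
    * prod_from k1 (\<lambda>k. Xi Plus k p)
    * prod_below k2 (\<lambda>k. Xi Minus k p)
    * prod_from 1 (\<lambda>k. Xi_inf Plus k p)"

definition g_minf :: "int \<Rightarrow> int \<Rightarrow> point \<Rightarrow> complex"
  where "g_minf k2 k1 p =
    exp (of_real pi * \<i> / 12)
    * prod_from k2 (\<lambda>k. Xi Minus k p)
    * prod_below k1 (\<lambda>k. Xi Plus k p)
    * prod_from 1 (\<lambda>k. Xi_inf Minus k p)"

definition has_original_transition_functions ::
  "(complex \<Rightarrow> 'e \<Rightarrow> 'e) \<Rightarrow> (sign \<Rightarrow> int \<Rightarrow> point \<Rightarrow> 'e) \<Rightarrow> bool"
  where
  "has_original_transition_functions scl Z \<longleftrightarrow>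
     (\<forall>s k1 k2. k1 < k2 \<longrightarrow>
        transition_function scl (cover s k1 \<inter> cover s k2) (Z s k1) (Z s k2) (g_sec s k1 k2)) \<and>
     (\<forall>k1 k2.
        transition_function scl (overlap_inf Plus k1 k2) (Z Plus k1) (Z Minus k2) (g_inf k1 k2)) \<and>
     (\<forall>k1 k2.
        transition_function scl (overlap_inf Minus k1 k2) (Z Minus k2) (Z Plus k1) (g_minf k2 k1))"


section \<open>The Riemann--Hilbert problem and its logarithmic solutions\<close>

text \<open>Logarithmic jumps; the letters \<open>b\<close> and \<open>d\<close> refer to the dual charges \<open>\<beta>\<^sup>\<or>\<close> and \<open>\<delta>\<^sup>\<or>\<close>.\<close>

definition jump_b :: "sign \<Rightarrow> int \<Rightarrow> point \<Rightarrow> complex"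
  where "jump_b s k p = pm s (Ln (1 - X_charge (pm s (1, k)) p))"

definition jump_d :: "sign \<Rightarrow> int \<Rightarrow> point \<Rightarrow> complex"
  where "jump_d s k p = pm s (of_int k * Ln (1 - X_charge (pm s (1, k)) p))"

definition jump_b_inf :: "int \<Rightarrow> int \<Rightarrow> point \<Rightarrow> complex"
  where "jump_b_inf k1 k2 p =
    sum_from k1 (\<lambda>k. Ln (1 - X_charge (1, k) p))
    - sum_from (- k2 + 1) (\<lambda>k. Ln (1 - X_charge (- 1, k) p))"

definition jump_d_inf :: "int \<Rightarrow> int \<Rightarrow> point \<Rightarrow> complex"
  where "jump_d_inf k1 k2 p =
    sum_from k1 (\<lambda>k. of_int k * Ln (1 - X_charge (1, k) p))
    + sum_from (- k2 + 1) (\<lambda>k. of_int k * Ln (1 - X_charge (- 1, k) p))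
    - sum_from 1 (\<lambda>k. 2 * of_int k * Ln (1 - X_charge (0, k) p))"

definition jump_b_minf :: "int \<Rightarrow> int \<Rightarrow> point \<Rightarrow> complex"
  where "jump_b_minf k2 k1 p =
    - sum_from k2 (\<lambda>k. Ln (1 - X_charge (- 1, - k) p))
    + sum_from (- k1 + 1) (\<lambda>k. Ln (1 - X_charge (1, - k) p))"

definition jump_d_minf :: "int \<Rightarrow> int \<Rightarrow> point \<Rightarrow> complex"
  where "jump_d_minf k2 k1 p =
    - sum_from k2 (\<lambda>k. of_int k * Ln (1 - X_charge (- 1, - k) p))
    - sum_from (- k1 + 1) (\<lambda>k. of_int k * Ln (1 - X_charge (1, - k) p))
    + sum_from 1 (\<lambda>k. 2 * of_int k * Ln (1 - X_charge (0, - k) p))"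

text \<open>
  \<open>app J y\<close> is the effect of the jump \<open>J\<close> on the value \<open>y\<close>: \<open>y + J\<close> for the logarithms, and
  \<open>exp J * y\<close> for the solutions of the Riemann--Hilbert problem themselves.
\<close>

definition has_jumps ::
  "(complex \<Rightarrow> complex \<Rightarrow> complex) \<Rightarrow> (sign \<Rightarrow> int \<Rightarrow> point \<Rightarrow> complex)
     \<Rightarrow> (sign \<Rightarrow> int \<Rightarrow> point \<Rightarrow> complex) \<Rightarrow> bool"
  where
  "has_jumps app yb yd \<longleftrightarrow>
     (\<forall>s k. \<forall>p \<in> cover s k \<inter> cover s (k + 1).
        yb s (k + 1) p = app (jump_b s k p) (yb s k p) \<and>
        yd s (k + 1) p = app (jump_d s k p) (yd s k p)) \<and>
     (\<forall>k1 k2. \<forall>p \<in> overlap_inf Plus k1 k2.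
        yb Minus k2 p = app (jump_b_inf k1 k2 p) (yb Plus k1 p) \<and>
        yd Minus k2 p = app (jump_d_inf k1 k2 p) (yd Plus k1 p)) \<and>
     (\<forall>k1 k2. \<forall>p \<in> overlap_inf Minus k1 k2.
        yb Plus k1 p = app (jump_b_minf k2 k1 p) (yb Minus k2 p) \<and>
        yd Plus k1 p = app (jump_d_minf k2 k1 p) (yd Minus k2 p))"

definition RH_regular :: "complex set \<Rightarrow> (complex \<Rightarrow> complex) \<Rightarrow> bool"
  where
  "RH_regular H F \<longleftrightarrow>
     F holomorphic_on H \<and>
     (\<forall>l\<in>H. F l \<noteq> 0) \<and>
     (F \<longlongrightarrow> 1) (at 0 within H) \<and>
     (\<exists>(N::nat) (C::real) (R::real). \<forall>l\<in>H. cmod l \<ge> R \<longrightarrow>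
        cmod (F l) \<le> C * cmod l ^ N \<and> cmod (inverse (F l)) \<le> C * cmod l ^ N)"

definition solves_Bridgeland_RH ::
  "(sign \<Rightarrow> int \<Rightarrow> point \<Rightarrow> complex) \<Rightarrow> (sign \<Rightarrow> int \<Rightarrow> point \<Rightarrow> complex) \<Rightarrow> bool"
  where
  "solves_Bridgeland_RH Xb Xd \<longleftrightarrow>
     (\<forall>s k v w. (v, w) \<in> M_plus \<longrightarrow>
        RH_regular (half_plane (signed_ray s (rho k v w))) (\<lambda>l. Xb s k (l, v, w)) \<and>
        RH_regular (half_plane (signed_ray s (rho k v w))) (\<lambda>l. Xd s k (l, v, w))) \<and>
     has_jumps (\<lambda>J y. exp J * y) Xb Xd"

definition logarithms_of_RH_solution ::
  "(sign \<Rightarrow> int \<Rightarrow> point \<Rightarrow> complex) \<Rightarrow> (sign \<Rightarrow> int \<Rightarrow> point \<Rightarrow> complex)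
     \<Rightarrow> (sign \<Rightarrow> int \<Rightarrow> point \<Rightarrow> complex) \<Rightarrow> (sign \<Rightarrow> int \<Rightarrow> point \<Rightarrow> complex) \<Rightarrow> bool"
  where
  "logarithms_of_RH_solution Xb Xd xb xd \<longleftrightarrow>
     (\<forall>s k. \<forall>p \<in> cover s k. exp (xb s k p) = Xb s k p \<and> exp (xd s k p) = Xd s k p) \<and>
     has_jumps (\<lambda>J y. y + J) xb xd"

definition f_rho ::
  "(sign \<Rightarrow> int \<Rightarrow> point \<Rightarrow> complex) \<Rightarrow> (sign \<Rightarrow> int \<Rightarrow> point \<Rightarrow> complex) \<Rightarrow> sign \<Rightarrow> int \<Rightarrow> point \<Rightarrow> complex"
  where "f_rho xb xd s k = (\<lambda>(l, v, w).
    2 * of_real pi * \<i> * v / l * xb s k (l, v, w) + 2 * of_real pi * \<i> * w / l * xd s k (l, v, w))"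


section \<open>The new local trivializations and their transition functions\<close>

definition new_frame ::
  "(complex \<Rightarrow> 'e \<Rightarrow> 'e) \<Rightarrow> (sign \<Rightarrow> int \<Rightarrow> point \<Rightarrow> 'e)
     \<Rightarrow> (sign \<Rightarrow> int \<Rightarrow> point \<Rightarrow> complex) \<Rightarrow> (sign \<Rightarrow> int \<Rightarrow> point \<Rightarrow> complex) \<Rightarrow> sign \<Rightarrow> int \<Rightarrow> point \<Rightarrow> 'e"
  where "new_frame scl Z xb xd s k p =
    scl (exp (\<i> / (4 * of_real pi) * f_rho xb xd s k p - pm s (\<i> * of_real pi / 24))) (Z s k p)"

definition Rogers_factor :: "charge \<Rightarrow> charge \<Rightarrow> point \<Rightarrow> complex"
  where "Rogers_factor \<gamma> \<gamma>' p = exp (of_int (BPS \<gamma>) / (2 * of_real pi * \<i>) * Rogers \<gamma>' p)"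

definition g_new :: "sign \<Rightarrow> int \<Rightarrow> int \<Rightarrow> point \<Rightarrow> complex"
  where "g_new s k1 k2 p = (\<Prod>k\<in>{k1..<k2}. Rogers_factor (1, k) (pm s (1, k)) p)"

definition g_new_inf :: "int \<Rightarrow> int \<Rightarrow> point \<Rightarrow> complex"
  where "g_new_inf k1 k2 p =
    prod_from k1 (\<lambda>k. Rogers_factor (1, k) (1, k) p)
    * prod_below k2 (\<lambda>k. Rogers_factor (1, k) (- (1, k)) p)
    * prod_from 1 (\<lambda>k. Rogers_factor (0, k) (0, k) p)"

definition g_new_minf :: "int \<Rightarrow> int \<Rightarrow> point \<Rightarrow> complex"
  where "g_new_minf k2 k1 p =
    prod_from k2 (\<lambda>k. Rogers_factor (1, k) (- (1, k)) p)
    * prod_below k1 (\<lambda>k. Rogers_factor (1, k) (1, k) p)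
    * prod_from 1 (\<lambda>k. Rogers_factor (0, k) (- (0, k)) p)"

end

theory Submission
  imports Defs
begin

text \<open>
  Since \<open>\<partial>(\<lambda> Li\<^sub>2(X)) = Li\<^sub>2(X) + log X log (1 - X)\<close> for \<open>\<partial> = \<partial>/\<partial>\<lambda>\<close>, every factor \<open>\<Xi>\<close> differs from
  the corresponding Rogers factor by the exponential of a multiple of \<open>log X log (1 - X)\<close>.  The jump
  of \<open>f\<close> is the sum of these products, because \<open>log X\<close> is linear in the charge, so the
  factor \<open>exp (i f / 4\<pi>)\<close> of the new frames removes them; the constants \<open>\<mp>i\<pi>/24\<close> remove
  \<open>e\<^bsup>\<mp>i\<pi>/12\<^esup>\<close>.  On the overlaps all \<open>X\<close> have modulus below 1: the number
  \<open>Im ((v + k w) cnj \<lambda>)\<close> is affine in \<open>k\<close>, and the half-plane centered at \<open>\<rho>\<^sub>k\<close> forces it to be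
  positive for \<open>k\<close> or for \<open>k - 1\<close>.  In the infinite products the terms decay geometrically
  in \<open>k\<close>.
\<close>

section \<open>Geometry of the cover\<close>

text \<open>Writing \<open>l = u * z\<close> gives \<open>Re (u * cnj l) = |u|^2 * Re z\<close>, so
  the two sign conditions agree; for the converse take \<open>z = l / u\<close>. Membership becomes
  the sign of a real linear form in \<open>u\<close>.\<close>

lemma mem_half_plane_iff:
  assumes "l \<noteq> 0"
  shows "l \<in> half_plane R \<longleftrightarrow> (\<exists>u\<in>R. 0 < Re (u * cnj l))"
proof
  assume "l \<in> half_plane R"
  then obtain u z where u: "u \<in> R" "0 < Re z" "l = u * z"
    by (auto simp: half_plane_def)
  have "Re (u * cnj l) = (cmod u)\<^sup>2 * Re z"
    unfolding cmod_power2 u(3) by (simp add: power2_eq_square algebra_simps)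
  moreover have "u \<noteq> 0" using u(3) assms by auto
  ultimately show "\<exists>u\<in>R. 0 < Re (u * cnj l)"
    using u by (intro bexI[of _ u]) auto
next
  assume "\<exists>u\<in>R. 0 < Re (u * cnj l)"
  then obtain u where u: "u \<in> R" "0 < Re (u * cnj l)" by blast
  then have "u \<noteq> 0" by auto
  have "Re (u * cnj l) = Re (l * cnj u)" by (simp add: algebra_simps)
  then have "0 < Re (l / u)"
    using u(2) by (simp only: Re_complex_div_gt_0)
  then show "l \<in> half_plane R"
    using u(1) \<open>u \<noteq> 0\<close> unfolding half_plane_def
    by (intro CollectI exI[of _ u] exI[of _ "l / u"]) auto
qed

text \<open>Vectors of length \<open>r\<close> on the two rays are
  \<open>- i r sgn (v + n w)\<close> for \<open>n = k\<close> and \<open>n = k - 1\<close>, since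
  \<open>sgn\<close> normalizes to modulus 1; their sums sweep out the middle ray as
  \<open>r\<close> varies.\<close>

lemma rho_eq:
  assumes "(v, w) \<in> M_plus"
  shows "rho k v w =
    {- (of_real r * \<i> * (sgn (v + of_int k * w) + sgn (v + of_int (k - 1) * w))) | r. 0 < r}"
    (is "_ = ?R")
proof (intro set_eqI iffI)
  have nz: "v + of_int n * w \<noteq> 0" for n :: int
    using assms by (simp add: M_plus_def M_conifold_def)
  {
    fix x assume "x \<in> rho k v w"
    then obtain t t' where t: "t < 0" "t' < 0"
      and x: "x = of_real t * (2 * of_real pi * \<i> * (v + of_int k * w))
        + of_real t' * (2 * of_real pi * \<i> * (v + of_int (k - 1) * w))"
      and eq: "cmod (of_real t * (2 * of_real pi * \<i> * (v + of_int k * w)))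
        = cmod (of_real t' * (2 * of_real pi * \<i> * (v + of_int (k - 1) * w)))"
      unfolding rho_def middle_ray_def L_ray_def neg_ray_def by blast
    \<comment> \<open>The common modulus of the two summands; the sign is there because
      \<open>t < 0\<close>.\<close>
    define r where "r = - t * 2 * pi * cmod (v + of_int k * w)"
    have r': "r = - t' * 2 * pi * cmod (v + of_int (k - 1) * w)"
      using eq t by (simp add: r_def norm_mult)
    have "of_real t * (2 * of_real pi * \<i> * (v + of_int k * w))
        = - (of_real r * \<i> * sgn (v + of_int k * w))"
      using nz[of k] by (simp add: r_def sgn_eq)
    moreover have "of_real t' * (2 * of_real pi * \<i> * (v + of_int (k - 1) * w))
        = - (of_real r * \<i> * sgn (v + of_int (k - 1) * w))"
      unfolding r' using nz[of "k - 1"] by (simp add: sgn_eq)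
    ultimately have "x = - (of_real r * \<i> * (sgn (v + of_int k * w) + sgn (v + of_int (k - 1) * w)))"
      unfolding x by (simp only: distrib_left minus_add_distrib)
    moreover have "0 < r" using t nz[of k] by (simp add: r_def mult_neg_pos)
    ultimately show "x \<in> ?R" by blast
  next
    fix x assume "x \<in> ?R"
    then obtain r where r: "0 < r"
      and x: "x = - (of_real r * \<i> * (sgn (v + of_int k * w) + sgn (v + of_int (k - 1) * w)))"
      by blast
    have "- (of_real r * \<i> * sgn (v + of_int n * w)) \<in> L_ray n v w" for n
      unfolding L_ray_def neg_ray_def using r nz[of n]
      by (intro CollectI exI[of _ "- r / (2 * pi * cmod (v + of_int n * w))"])
         (simp add: sgn_eq divide_simps)
    moreover have "cmod (- (of_real r * \<i> * sgn (v + of_int n * w))) = r" for n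
      using r nz[of n] by (simp add: norm_mult norm_sgn)
    ultimately show "x \<in> rho k v w"
      unfolding rho_def middle_ray_def x
      by (intro CollectI exI[of _ "- (of_real r * \<i> * sgn (v + of_int k * w))"]
          exI[of _ "- (of_real r * \<i> * sgn (v + of_int (k - 1) * w))"])
         (simp only: distrib_left minus_add_distrib simp_thms)
  }
qed

text \<open>The factor \<open>- i\<close> turns real parts into imaginary parts, and the positive
  factor \<open>r\<close> does not affect the sign.\<close>

lemma mem_half_plane_rho_iff:
  assumes "l \<noteq> 0" "(v, w) \<in> M_plus"
  defines "h \<equiv> \<lambda>n::int. Im ((v + of_int n * w) * cnj l) / cmod (v + of_int n * w)"
  shows "l \<in> half_plane (signed_ray s (rho k v w)) \<longleftrightarrow> 0 < pm s (h k + h (k - 1))"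
proof -
  have h: "Im (sgn (v + of_int n * w) * cnj l) = h n" for n
    by (simp only: h_def sgn_eq times_divide_eq_left Im_divide_of_real)
  have "Re (pm s (- (of_real r * \<i> * (a + b))) * cnj l)
      = r * pm s (Im (a * cnj l) + Im (b * cnj l))" for a b and r :: real
    by (cases s) (simp_all add: algebra_simps)
  then have *: "Re (pm s (- (of_real r * \<i> * (sgn (v + of_int k * w) + sgn (v + of_int (k - 1) * w)))) * cnj l)
      = r * pm s (h k + h (k - 1))" for r
    by (simp only: h)
  show ?thesis
    unfolding mem_half_plane_iff[OF assms(1)] signed_ray_def rho_eq[OF assms(2)]
  proof safe
    fix r assume "0 < r" and "0 < Re (pm s (- (of_real r * \<i> * (sgn (v + of_int k * w) + sgn (v + of_int (k - 1) * w)))) * cnj l)"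
    then show "0 < pm s (h k + h (k - 1))"
      unfolding * by (simp add: zero_less_mult_iff)
  next
    assume pos: "0 < pm s (h k + h (k - 1))"
    show "\<exists>u\<in>pm s ` {- (of_real r * \<i> * (sgn (v + of_int k * w) + sgn (v + of_int (k - 1) * w))) | r. 0 < r}.
       0 < Re (u * cnj l)"
    proof (rule bexI)
      show "0 < Re (pm s (- (of_real 1 * \<i> * (sgn (v + of_int k * w) + sgn (v + of_int (k - 1) * w)))) * cnj l)"
        unfolding * using pos by simp
    qed (intro imageI CollectI exI[of _ 1] conjI refl zero_less_one)
  qed
qed

section \<open>Where \<open>|X| < 1\<close>: the sign of \<open>Re (logX \<gamma> p)\<close> on
  overlaps of equal sign\<close>

text \<open>The factor \<open>2 pi i\<close> turns the real part into a negative multiple of the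
  imaginary part, and division by \<open>l\<close> differs from multiplication by
  \<open>cnj l\<close> only by the positive factor \<open>|l|^2\<close>.\<close>

lemma Re_logX_neg_iff:
  assumes "l \<noteq> 0"
  shows "Re (logX (n, m) (l, v, w)) < 0 \<longleftrightarrow> 0 < Im ((of_int n * v + of_int m * w) * cnj l)"
proof -
  have "Re (2 * of_real pi * \<i> * z * cnj l) = - (2 * pi * Im (z * cnj l))" for z
    by (simp add: algebra_simps)
  then show ?thesis
    unfolding logX_def using pi_gt_zero
    by (simp only: prod.case Re_complex_div_lt_0 neg_less_0_iff_less zero_less_mult_iff) simp
qed

lemma mem_cover_iff:
  "(l, v, w) \<in> cover s k \<longleftrightarrow> l \<noteq> 0 \<and> (v, w) \<in> M_plus \<and> l \<in> half_plane (signed_ray s (rho k v w))"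
  by (simp add: cover_def)

text \<open>A positive sum with positive weights has a positive summand, at \<open>k\<close> or at
  \<open>k - 1\<close>; monotonicity of the affine function carries positivity upwards from
  \<open>k\<close> or downwards from \<open>k - 1\<close>.\<close>

lemma affine_weighted_sum_pos:
  fixes h0 h1 :: real and N :: "int \<Rightarrow> real"
  assumes N: "\<And>n. 0 < N n"
    and pos: "0 < (h0 + of_int k * h1) / N k + (h0 + of_int (k - 1) * h1) / N (k - 1)"
  shows "\<lbrakk>0 \<le> h1; k \<le> n\<rbrakk> \<Longrightarrow> 0 < h0 + of_int n * h1"
    and "\<lbrakk>h1 \<le> 0; n < k\<rbrakk> \<Longrightarrow> 0 < h0 + of_int n * h1"
proof -
  have *: "0 < h0 + of_int k * h1 \<or> 0 < h0 + of_int (k - 1) * h1"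
  proof (rule ccontr)
    assume "\<not> ?thesis"
    then have "(h0 + of_int k * h1) / N k \<le> 0" "(h0 + of_int (k - 1) * h1) / N (k - 1) \<le> 0"
      using N[of k] N[of "k - 1"] by (auto simp: divide_le_0_iff)
    then show False using pos by linarith
  qed
  {
    assume "0 \<le> h1" "k \<le> n"
    then have "of_int (k - 1) * h1 \<le> of_int n * h1" "of_int k * h1 \<le> of_int n * h1"
      by (auto intro!: mult_right_mono)
    then show "0 < h0 + of_int n * h1" using * by linarith
  next
    assume "h1 \<le> 0" "n < k"
    then have "of_int (k - 1) * h1 \<le> of_int n * h1" "of_int k * h1 \<le> of_int n * h1"
      by (auto intro!: mult_right_mono_neg)
    then show "0 < h0 + of_int n * h1" using * by linarith
  }
qed

text \<open>
  The sign of \<open>Im ((v + n w) cnj l)\<close>, which is affine in \<open>n\<close>, decides on which side of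
  the ray spanned by \<open>\<L>\<^sub>n\<close> the point \<open>l\<close> lies.
\<close>

lemma cover_affine:
  assumes "(l, v, w) \<in> cover s k"
  defines "h0 \<equiv> pm s (Im (v * cnj l))" and "h1 \<equiv> pm s (Im (w * cnj l))"
  shows "\<lbrakk>0 \<le> h1; k \<le> n\<rbrakk> \<Longrightarrow> 0 < h0 + of_int n * h1"
    and "\<lbrakk>h1 \<le> 0; n < k\<rbrakk> \<Longrightarrow> 0 < h0 + of_int n * h1"
proof -
  have l: "l \<noteq> 0" and vw: "(v, w) \<in> M_plus"
    and mem: "l \<in> half_plane (signed_ray s (rho k v w))"
    using assms(1) by (auto simp: mem_cover_iff)
  have N: "0 < cmod (v + of_int n * w)" for n :: int
    using vw by (simp add: M_plus_def M_conifold_def)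
  have "0 < (h0 + of_int k * h1) / cmod (v + of_int k * w)
      + (h0 + of_int (k - 1) * h1) / cmod (v + of_int (k - 1) * w)"
    using mem unfolding mem_half_plane_rho_iff[OF l vw] h0_def h1_def
    by (cases s) (simp_all add: add_divide_distrib diff_divide_distrib algebra_simps)
  note * = affine_weighted_sum_pos[of "\<lambda>n. cmod (v + of_int n * w)", OF N this]
  show "\<lbrakk>0 \<le> h1; k \<le> n\<rbrakk> \<Longrightarrow> 0 < h0 + of_int n * h1"
    and "\<lbrakk>h1 \<le> 0; n < k\<rbrakk> \<Longrightarrow> 0 < h0 + of_int n * h1"
    by (rule *; assumption)+
qed

lemma Re_logX_pm_neg_iff:
  assumes "l \<noteq> 0"
  shows "Re (logX (pm s (n, m)) (l, v, w)) < 0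
    \<longleftrightarrow> 0 < of_int n * pm s (Im (v * cnj l)) + of_int m * pm s (Im (w * cnj l))"
  by (cases s) (simp_all add: Re_logX_neg_iff[OF assms] algebra_simps)

text \<open>If the slope in \<open>k\<close> is nonnegative, positivity spreads upwards from
  \<open>k1\<close>; if it is nonpositive, it spreads downwards from below
  \<open>k2\<close>.\<close>

lemma cover_Re_logX_neg:
  assumes p: "p \<in> cover s k1" "p \<in> cover s k2" and k: "k1 \<le> k" "k < k2"
  shows "Re (logX (pm s (1, k)) p) < 0"
proof -
  obtain l v w where lvw: "p = (l, v, w)" by (cases p)
  then have "l \<noteq> 0" using p(1) by (simp add: mem_cover_iff)
  then have "Re (logX (pm s (1, k)) (l, v, w)) < 0
      \<longleftrightarrow> 0 < pm s (Im (v * cnj l)) + of_int k * pm s (Im (w * cnj l))"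
    by (subst Re_logX_pm_neg_iff) simp_all
  then show ?thesis
    using cover_affine[of l v w s _ k] p k unfolding lvw by (meson linear)
qed

text \<open>For \<open>k\<close> strictly between, both \<open>k\<close> and \<open>k - 1\<close>
  lie in the range from \<open>k1\<close> to \<open>k2 - 1\<close>, so both terms in the criterion
  for \<open>rho k\<close> are positive. This allows jumps of neighbouring sectors to be
  chained.\<close>

lemma cover_between:
  assumes p: "p \<in> cover s k1" "p \<in> cover s k2" and k: "k1 \<le> k" "k \<le> k2"
  shows "p \<in> cover s k"
proof (cases "k = k1 \<or> k = k2")
  case True
  then show ?thesis using p by auto
next
  case False
  obtain l v w where lvw: "p = (l, v, w)" by (cases p)
  have l: "l \<noteq> 0" and vw: "(v, w) \<in> M_plus" using p(1) by (auto simp: lvw mem_cover_iff)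
  have pos: "0 < pm s (Im ((v + of_int n * w) * cnj l) / cmod (v + of_int n * w))"
    if "k1 \<le> n" "n < k2" for n
  proof -
    have "0 < pm s (Im ((v + of_int n * w) * cnj l))"
      using cover_Re_logX_neg[OF p that] unfolding lvw Re_logX_pm_neg_iff[OF l]
      by (cases s) (simp_all add: algebra_simps)
    moreover have "0 < cmod (v + of_int n * w)"
      using vw by (simp add: M_plus_def M_conifold_def)
    ultimately have "0 < pm s (Im ((v + of_int n * w) * cnj l)) / cmod (v + of_int n * w)"
      by (rule divide_pos_pos)
    then show ?thesis by (cases s; simp only: pm.simps minus_divide_left)
  qed
  have add: "pm s (a + b) = pm s a + pm s b" for a b :: real by (cases s) simp_all
  show ?thesis
    unfolding lvw mem_cover_iff mem_half_plane_rho_iff[OF l vw] add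
    using l vw pos[of k] pos[of "k - 1"] False k by simp
qed

section \<open>Overlaps whose sector contains one of the rays
  \<open>\<plusminus>L_inf\<close>\<close>

text \<open>An open half-plane is convex, so it contains the convex hull of any two rays inside
  it.\<close>

lemma pos_on_smaller_sector:
  assumes "\<And>u. u \<in> R \<Longrightarrow> 0 < Re (u * c)" "\<And>u. u \<in> R' \<Longrightarrow> 0 < Re (u * c)"
    and "x \<in> smaller_sector R R'"
  shows "0 < Re (x * c)"
proof -
  have "convex {x. 0 < Re (x * c)}"
    using convex_halfspace_gt[of 0 "cnj c"] by (simp add: inner_complex_def algebra_simps)
  then have "convex hull (R \<union> R') \<subseteq> {x. 0 < Re (x * c)}"
    using assms(1,2) by (intro hull_minimal) auto
  then show ?thesis using assms(3) by (auto simp: smaller_sector_def)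
qed

text \<open>Points of the ray are positive multiples of each other, so positivity at one point, as
  given by the cover, holds at all of them.\<close>

lemma half_plane_pos:
  assumes "(l, v, w) \<in> cover s k" "u \<in> signed_ray s (rho k v w)"
  shows "0 < Re (u * cnj l)"
proof -
  have l: "l \<noteq> 0" and vw: "(v, w) \<in> M_plus"
    and mem: "l \<in> half_plane (signed_ray s (rho k v w))"
    using assms(1) by (auto simp: mem_cover_iff)
  obtain u' where u': "u' \<in> signed_ray s (rho k v w)" "0 < Re (u' * cnj l)"
    using mem unfolding mem_half_plane_iff[OF l] by blast
  obtain r where r: "0 < r" "u = of_real r * u'"
  proof -
    obtain r1 r2 where r: "0 < r1" "0 < r2"
      "u = pm s (- (of_real r1 * \<i> * (sgn (v + of_int k * w) + sgn (v + of_int (k - 1) * w))))"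
      "u' = pm s (- (of_real r2 * \<i> * (sgn (v + of_int k * w) + sgn (v + of_int (k - 1) * w))))"
      using assms(2) u'(1) unfolding signed_ray_def rho_eq[OF vw] by blast
    have "u = of_real (r1 / r2) * u'"
      using r(1,2) unfolding r(3,4) by (cases s) simp_all
    with r(1,2) show ?thesis by (intro that[of "r1 / r2"]) auto
  qed
  have "Re (u * cnj l) = r * Re (u' * cnj l)" using r(2) by (simp add: algebra_simps)
  then show ?thesis using r(1) u'(2) by simp
qed

text \<open>Both bounding rays lie in the half-plane \<open>Re (u * cnj l) > 0\<close>, hence so
  does the sector between them and with it the ray \<open>\<plusminus>L_inf\<close>. Thus
  \<open>|X|\<close> is below 1 for the charge \<open>\<plusminus>\<delta>\<close>, the ratio of the
  later geometric series.\<close>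

lemma overlap_inf_Re_logX_neg_delta:
  assumes "p \<in> overlap_inf s k1 k2"
  shows "Re (logX (pm s (0, 1)) p) < 0"
proof -
  obtain l v w where lvw: "p = (l, v, w)" by (cases p)
  have c: "(l, v, w) \<in> cover Plus k1" "(l, v, w) \<in> cover Minus k2"
    and sub: "signed_ray s (L_inf w) \<subseteq> smaller_sector (rho k1 v w) (signed_ray Minus (rho k2 v w))"
    using assms by (auto simp: overlap_inf_def lvw)
  have l: "l \<noteq> 0" using c by (simp add: mem_cover_iff)
  have plus: "0 < Re (u * cnj l)" if "u \<in> rho k1 v w" for u
  proof -
    have "rho k1 v w = signed_ray Plus (rho k1 v w)" by (simp add: signed_ray_def)
    with that show ?thesis using half_plane_pos[OF c(1)] by blast
  qed
  have "pm s (of_real (- 1) * (2 * of_real pi * \<i> * w)) \<in> signed_ray s (L_inf w)"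
    unfolding signed_ray_def L_inf_def neg_ray_def by (intro imageI CollectI exI[of _ "-1"]) simp
  then have mem: "pm s (of_real (- 1) * (2 * of_real pi * \<i> * w))
      \<in> smaller_sector (rho k1 v w) (signed_ray Minus (rho k2 v w))"
    using sub by blast
  have "0 < Re (pm s (of_real (- 1) * (2 * of_real pi * \<i> * w)) * cnj l)"
    by (rule pos_on_smaller_sector[OF plus half_plane_pos[OF c(2)] mem])
  also have "\<dots> = 2 * pi * pm s (Im (w * cnj l))"
    by (cases s) (simp_all add: algebra_simps)
  finally show ?thesis
    by (simp add: lvw Re_logX_pm_neg_iff[OF l] zero_less_mult_iff)
qed

text \<open>Here \<open>a\<close> indexes the cover set of sign \<open>s\<close> and
  \<open>b\<close> the one of opposite sign. The slope \<open>pm s (Im (w * cnj l))\<close> is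
  positive, so positivity spreads upwards from \<open>a\<close>; for the opposite sign the slope is
  negative and it spreads downwards from \<open>b - 1\<close>.\<close>

lemma overlap_inf_Re_logX_neg:
  assumes "p \<in> overlap_inf s k1 k2"
  defines "a \<equiv> (if s = Plus then k1 else k2)" and "b \<equiv> (if s = Plus then k2 else k1)"
  shows "a \<le> k \<Longrightarrow> Re (logX (pm s (1, k)) p) < 0"
    and "- b < k \<Longrightarrow> Re (logX (pm s (- 1, k)) p) < 0"
proof -
  obtain l v w where lvw: "p = (l, v, w)" by (cases p)
  have c: "(l, v, w) \<in> cover Plus k1" "(l, v, w) \<in> cover Minus k2"
    using assms by (auto simp: overlap_inf_def lvw)
  have l: "l \<noteq> 0" using c by (simp add: mem_cover_iff)
  have w: "0 < pm s (Im (w * cnj l))"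
    using overlap_inf_Re_logX_neg_delta[OF assms(1)] by (simp add: lvw Re_logX_pm_neg_iff[OF l])
  have pos_iff: "Re (logX (pm s (1, k)) (l, v, w)) < 0
      \<longleftrightarrow> 0 < pm s (Im (v * cnj l)) + of_int k * pm s (Im (w * cnj l))"
    and neg_iff: "Re (logX (pm s (- 1, k)) (l, v, w)) < 0
      \<longleftrightarrow> 0 < - pm s (Im (v * cnj l)) + of_int k * pm s (Im (w * cnj l))"
    by (subst Re_logX_pm_neg_iff[OF l]; simp)+
  have s: "(l, v, w) \<in> cover s a" "(l, v, w) \<in> cover (if s = Plus then Minus else Plus) b"
    using c by (cases s; simp add: a_def b_def)+
  show "Re (logX (pm s (1, k)) p) < 0" if "a \<le> k"
    unfolding lvw pos_iff using w that by (intro cover_affine(1)[OF s(1)]) auto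
  show "Re (logX (pm s (- 1, k)) p) < 0" if "- b < k"
  proof -
    \<comment> \<open>The affine form of opposite sign is evaluated at \<open>- k\<close>, which
      lies below \<open>b\<close>.\<close>
    have "0 < pm (if s = Plus then Minus else Plus) (Im (v * cnj l))
        + of_int (- k) * pm (if s = Plus then Minus else Plus) (Im (w * cnj l))"
      using w that by (intro cover_affine(2)[OF s(2)]) (cases s; simp)+
    then show ?thesis
      unfolding lvw neg_iff
      by (cases s) (simp_all only: pm.simps of_int_minus mult_minus_left mult_minus_right
          minus_minus if_True if_False sign.distinct simp_thms)
  qed
qed

section \<open>The dilogarithm\<close>

lemma summable_Li2_coeffs:
  fixes z :: complex
  assumes "norm z \<le> 1"
  shows "summable (\<lambda>n. z ^ n / (of_nat n)\<^sup>2)" "summable (\<lambda>n. norm (z ^ n / (of_nat n)\<^sup>2))"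
proof -
  have "summable (\<lambda>n. inverse ((real n)\<^sup>2))" by (rule inverse_power_summable) simp
  moreover have "norm (norm (z ^ n / (of_nat n)\<^sup>2)) \<le> inverse ((real n)\<^sup>2)" for n
    using power_le_one[OF norm_ge_zero assms, of n]
    by (simp add: norm_divide norm_power inverse_eq_divide divide_right_mono)
  ultimately show "summable (\<lambda>n. norm (z ^ n / (of_nat n)\<^sup>2))"
    by (rule summable_comparison_test'[where N = 0])
  then show "summable (\<lambda>n. z ^ n / (of_nat n)\<^sup>2)" by (rule summable_norm_cancel)
qed

text \<open>The series may start at \<open>n = 0\<close> because that coefficient is
  \<open>1 / 0 = 0\<close>.\<close>

lemma Li2_eq:
  assumes "norm z \<le> 1"
  shows "Li2 z = (\<Sum>n. (1 / (of_nat n)\<^sup>2) * z ^ n)"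
  using suminf_split_head[OF summable_Li2_coeffs(1)[OF assms]] by (simp add: Li2_def)

text \<open>One factor \<open>z\<close> is split off and the remaining powers are bounded by 1, so
  that decay of \<open>X\<close> passes to \<open>Li2 X\<close>.\<close>

lemma norm_Li2_le:
  assumes "norm z \<le> 1"
  shows "norm (Li2 z) \<le> norm z * (\<Sum>n. 1 / (real (Suc n))\<^sup>2)"
proof -
  have s: "summable (\<lambda>n. 1 / (real (Suc n))\<^sup>2)"
    using inverse_power_summable[of 2, where ?'a = real] summable_Suc_iff[of "\<lambda>n. 1 / (real n)\<^sup>2"]
    by (simp add: inverse_eq_divide)
  have le: "norm (z ^ Suc n / (of_nat (Suc n))\<^sup>2) \<le> norm z * (1 / (real (Suc n))\<^sup>2)" for n
    using mult_left_mono[OF power_le_one[OF norm_ge_zero assms, of n], of "norm z"]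
    by (auto simp: norm_divide norm_power norm_mult simp del: of_nat_Suc intro!: divide_right_mono)
  have "norm (Li2 z) \<le> (\<Sum>n. norm z * (1 / (real (Suc n))\<^sup>2))"
    unfolding Li2_def by (rule norm_suminf_le[OF le summable_mult[OF s]])
  also have "\<dots> = norm z * (\<Sum>n. 1 / (real (Suc n))\<^sup>2)"
    by (rule suminf_mult[OF s])
  finally show ?thesis .
qed

text \<open>Termwise differentiation yields the sum of \<open>z ^ n / (n + 1)\<close>, which is the
  logarithm series divided by \<open>- z\<close>.\<close>

lemma Li2_has_field_derivative:
  assumes z: "norm z < 1" "z \<noteq> 0"
  shows "(Li2 has_field_derivative (- Ln (1 - z) / z)) (at z)"
proof -
  define c :: "nat \<Rightarrow> complex" where "c n = 1 / (of_nat n)\<^sup>2" for n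
  have "((\<lambda>x. \<Sum>n. c n * x ^ n) has_field_derivative (\<Sum>n. diffs c n * z ^ n)) (at z)"
    by (rule termdiffs_strong[where K = 1])
       (use summable_Li2_coeffs(1)[of 1] z in \<open>simp_all add: c_def\<close>)
  moreover have "(\<Sum>n. diffs c n * z ^ n) = - Ln (1 - z) / z"
  proof -
    have "(\<lambda>n. - (z ^ n) / of_nat n) sums Ln (1 - z)"
      using Ln_series'[of "- z"] z by simp
    then have "(\<lambda>n. - (z ^ Suc n) / of_nat (Suc n)) sums Ln (1 - z)"
      by (subst sums_Suc_iff) simp
    then have "(\<lambda>n. (- 1 / z) * (- (z ^ Suc n) / of_nat (Suc n))) sums ((- 1 / z) * Ln (1 - z))"
      by (rule sums_mult)
    moreover have "(- 1 / z) * (- (z ^ Suc n) / of_nat (Suc n)) = diffs c n * z ^ n" for n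
      using z by (simp add: diffs_def c_def power2_eq_square del: of_nat_Suc)
    ultimately show ?thesis by (simp add: sums_iff)
  qed
  ultimately have "((\<lambda>x. \<Sum>n. c n * x ^ n) has_field_derivative (- Ln (1 - z) / z)) (at z)"
    by simp
  then show ?thesis
    by (rule has_field_derivative_transform_within_open[where S = "ball 0 1"])
       (use z in \<open>auto simp: Li2_eq c_def\<close>)
qed

lemma norm_X_charge: "norm (X_charge \<gamma> p) = exp (Re (logX \<gamma> p))"
  by (simp add: X_charge_def)

text \<open>Chain rule for \<open>X = exp (K / l)\<close>: the factor \<open>X\<close> in
  \<open>dX/dl = - X K / l^2\<close> cancels the denominator of the derivative of
  \<open>Li2\<close>, and the outer factor \<open>l\<close> leaves
  \<open>K / l = logX\<close>.\<close>

lemma d_lambda_Li2_eq: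
  assumes "Re (logX \<gamma> p) < 0"
  shows "d_lambda_Li2 \<gamma> p = Li2 (X_charge \<gamma> p) + logX \<gamma> p * Ln (1 - X_charge \<gamma> p)"
proof -
  obtain n m l v w where g: "\<gamma> = (n, m)" and p: "p = (l, v, w)"
    by (cases \<gamma>, cases p) auto
  \<comment> \<open>For \<open>l = 0\<close> the quotient in \<open>logX\<close> would be 0, which
    is not negative.\<close>
  have l: "l \<noteq> 0" using assms by (auto simp: g p logX_def)
  define K where "K = 2 * of_real pi * \<i> * (of_int n * v + of_int m * w)"
  have K: "logX \<gamma> (l', v, w) = K / l'" for l' by (simp add: g logX_def K_def)
  have "norm (exp (K / l)) < 1" using assms by (simp add: p K)
  then have "(Li2 has_field_derivative (- Ln (1 - exp (K / l)) / exp (K / l))) (at (exp (K / l)))"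
    by (intro Li2_has_field_derivative) auto
  moreover have "((\<lambda>l'. exp (K / l')) has_field_derivative (exp (K / l) * (- K / l\<^sup>2))) (at l)"
    using l by (auto intro!: derivative_eq_intros simp: power2_eq_square)
  ultimately have "((\<lambda>l'. Li2 (exp (K / l'))) has_field_derivative
      (- Ln (1 - exp (K / l)) / exp (K / l)) * (exp (K / l) * (- K / l\<^sup>2))) (at l)"
    by (rule DERIV_chain2)
  then have "((\<lambda>l'. l' * Li2 (exp (K / l'))) has_field_derivative
      (Li2 (exp (K / l)) + K / l * Ln (1 - exp (K / l)))) (at l)"
    using l by (auto intro!: derivative_eq_intros simp: power2_eq_square)
  then show ?thesis
    by (simp add: d_lambda_Li2_def p X_charge_def K DERIV_imp_deriv)
qed

section \<open>Series along the charges \<open>n\<beta> + m\<delta>\<close> for growing \<open>m\<close>\<close>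

lemma logX_pm: "logX (pm s (n, m)) (l, v, w)
    = 2 * of_real pi * \<i> * (of_int n * pm s v + of_int m * pm s w) / l"
  by (cases s) (simp_all add: logX_def)

lemma logX_linear: "logX (pm s (n, m + int j)) p = logX (pm s (n, m)) p + of_nat j * logX (pm s (0, 1)) p"
  by (cases p) (simp add: logX_pm add_divide_distrib algebra_simps)

text \<open>Comparison with the differentiated geometric series, which also absorbs the factor
  \<open>j\<close> coming from the jumps at \<open>\<delta>\<^sup>\<or>\<close>.\<close>

lemma summable_geometric_bound:
  fixes F :: "nat \<Rightarrow> complex"
  assumes q: "0 \<le> q" "q < 1" and bnd: "\<And>j. N \<le> j \<Longrightarrow> norm (F j) \<le> C * q ^ j"
  shows "summable F" "summable (\<lambda>j. of_nat j * F j)"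
proof -
  have s: "summable (\<lambda>j. real (Suc j) * q ^ j)"
    using geometric_deriv_sums[of q] q by (simp add: sums_iff)
  have "norm (of_nat j * F j) \<le> C * (real (Suc j) * q ^ j)" if "N \<le> j" for j
  proof -
    have "0 \<le> C * q ^ j" using bnd[OF that] norm_ge_zero order_trans by blast
    then have "real j * norm (F j) \<le> real (Suc j) * (C * q ^ j)"
      using bnd[OF that] by (intro mult_mono) auto
    then show ?thesis by (simp add: norm_mult algebra_simps)
  qed
  then show "summable (\<lambda>j. of_nat j * F j)"
    by (rule summable_comparison_test'[OF summable_mult[OF s]])
  show "summable F"
    by (rule summable_comparison_test'[OF summable_mult[OF summable_geometric]])
       (use q bnd in auto)
qed

text \<open>Raising the second charge by 1 multiplies \<open>|X|\<close> by the fixed ratio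
  \<open>q < 1\<close>. The bound on \<open>Ln (1 - x j)\<close> holds once
  \<open>|x j| < 1/2\<close>, that on \<open>Li2\<close> for every \<open>j\<close>.\<close>

lemma X_charge_series_summable:
  assumes "Re (logX (pm s (0, 1)) p) < 0"
  and neg: "\<And>j. Re (logX (pm s (n, m + int j)) p) < 0"
  defines "x \<equiv> \<lambda>j. X_charge (pm s (n, m + int j)) p"
  shows "summable (\<lambda>j. Ln (1 - x j))" "summable (\<lambda>j. of_nat j * Ln (1 - x j))"
    "summable (\<lambda>j. Li2 (x j))"
proof -
  define q where "q = exp (Re (logX (pm s (0, 1)) p))"
  define A where "A = exp (Re (logX (pm s (n, m)) p))"
  have q: "0 \<le> q" "q < 1" using assms(1) by (simp_all add: q_def)
  have x: "norm (x j) = A * q ^ j" for j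
    by (simp add: x_def norm_X_charge A_def q_def logX_linear exp_add exp_of_nat_mult)
  have "(\<lambda>j. A * q ^ j) \<longlonglongrightarrow> A * 0"
    by (intro tendsto_mult tendsto_const LIMSEQ_realpow_zero q)
  then have "\<forall>\<^sub>F j in sequentially. A * q ^ j < 1 / 2"
    by (rule order_tendstoD) simp
  then obtain N where N: "\<And>j. N \<le> j \<Longrightarrow> A * q ^ j < 1 / 2"
    by (auto simp: eventually_sequentially)
  have "norm (Ln (1 - x j)) \<le> 2 * A * q ^ j" if "N \<le> j" for j
    using norm_Ln_le[of "- x j"] N[OF that] x[of j] by simp
  from summable_geometric_bound[OF q this]
  show "summable (\<lambda>j. Ln (1 - x j))" "summable (\<lambda>j. of_nat j * Ln (1 - x j))" by blast+
  have x1: "norm (x j) \<le> 1" for j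
    using neg[of j] by (simp add: x_def norm_X_charge)
  have "norm (Li2 (x j)) \<le> ((\<Sum>n. 1 / (real (Suc n))\<^sup>2) * A) * q ^ j" if "0 \<le> j" for j
    using norm_Li2_le[OF x1[of j]] by (simp add: x mult_ac)
  from summable_geometric_bound(1)[OF q this] show "summable (\<lambda>j. Li2 (x j))" by blast
qed

text \<open>As \<open>logX\<close> is linear in the charge, the series splits into a
  \<open>v\<close> part and a \<open>w\<close> part; these are the series in the jumps at
  \<open>\<beta>\<^sup>\<or>\<close> and \<open>\<delta>\<^sup>\<or>\<close>.\<close>

lemma sum_from_linear_combination:
  assumes "Re (logX (pm s (0, 1)) (l, v, w)) < 0"
    and "\<And>j. Re (logX (pm s (n, m + int j)) (l, v, w)) < 0"
  defines "y \<equiv> \<lambda>k. Ln (1 - X_charge (pm s (n, k)) (l, v, w))"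
  shows "summable (\<lambda>j. logX (pm s (n, m + int j)) (l, v, w) * y (m + int j))"
    and "(\<Sum>j. logX (pm s (n, m + int j)) (l, v, w) * y (m + int j)) =
      pm s (2 * of_real pi * \<i> / l)
        * (v * (of_int n * sum_from m y) + w * sum_from m (\<lambda>k. of_int k * y k))"
proof -
  note S = X_charge_series_summable[OF assms(1,2)]
  have 1: "(\<lambda>j. y (m + int j)) sums sum_from m y"
    using S(1) by (simp add: y_def sum_from_def summable_sums)
  have "summable (\<lambda>j. of_int m * y (m + int j) + of_nat j * y (m + int j))"
    unfolding y_def by (intro summable_add summable_mult S)
  then have 2: "(\<lambda>j. of_int (m + int j) * y (m + int j)) sums sum_from m (\<lambda>k. of_int k * y k)"
    unfolding sum_from_def by (intro summable_sums) (simp add: algebra_simps)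
  have "(\<lambda>j. pm s (2 * of_real pi * \<i> / l) * (v * (of_int n * y (m + int j))
        + w * (of_int (m + int j) * y (m + int j)))) sums
      (pm s (2 * of_real pi * \<i> / l)
        * (v * (of_int n * sum_from m y) + w * sum_from m (\<lambda>k. of_int k * y k)))"
    by (intro sums_mult sums_add 1 2)
  moreover have "pm s (2 * of_real pi * \<i> / l) * (v * (of_int n * y k) + w * (of_int k * y k))
      = logX (pm s (n, k)) (l, v, w) * y k" for k
    by (simp only: logX_pm) (cases s; simp add: add_divide_distrib diff_divide_distrib algebra_simps)
  ultimately have "(\<lambda>j. logX (pm s (n, m + int j)) (l, v, w) * y (m + int j)) sums
      (pm s (2 * of_real pi * \<i> / l)
        * (v * (of_int n * sum_from m y) + w * sum_from m (\<lambda>k. of_int k * y k)))"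
    by (simp only:)
  then show "summable (\<lambda>j. logX (pm s (n, m + int j)) (l, v, w) * y (m + int j))"
    and "(\<Sum>j. logX (pm s (n, m + int j)) (l, v, w) * y (m + int j)) =
      pm s (2 * of_real pi * \<i> / l)
        * (v * (of_int n * sum_from m y) + w * sum_from m (\<lambda>k. of_int k * y k))"
    by (simp_all add: sums_iff)
qed

text \<open>The derivative term exceeds the Rogers dilogarithm by half of
  \<open>logX * Ln (1 - X)\<close>. Both exponents are summable, so the product of exponentials
  splits accordingly.\<close>

lemma prodinf_Rogers:
  fixes C :: complex
  assumes neg: "\<And>j. Re (logX (c j) p) < 0"
    and S: "summable (\<lambda>j. Li2 (X_charge (c j) p))"
      "summable (\<lambda>j. logX (c j) p * Ln (1 - X_charge (c j) p))"
  shows "(\<Prod>j. exp (C * d_lambda_Li2 (c j) p))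
    = (\<Prod>j. exp (C * Rogers (c j) p))
      * exp (C / 2 * (\<Sum>j. logX (c j) p * Ln (1 - X_charge (c j) p)))"
proof -
  have R: "summable (\<lambda>j. C * Rogers (c j) p)"
    unfolding Rogers_def using S by (auto simp: mult.assoc intro!: summable_mult summable_add)
  have Y: "summable (\<lambda>j. C / 2 * (logX (c j) p * Ln (1 - X_charge (c j) p)))"
    by (intro summable_mult S)
  have eq: "C * d_lambda_Li2 (c j) p
      = C * Rogers (c j) p + C / 2 * (logX (c j) p * Ln (1 - X_charge (c j) p))" for j
    by (simp add: d_lambda_Li2_eq[OF neg] Rogers_def algebra_simps)
  have "(\<Prod>j. exp (C * d_lambda_Li2 (c j) p)) = exp ((\<Sum>j. C * Rogers (c j) p)
      + (\<Sum>j. C / 2 * (logX (c j) p * Ln (1 - X_charge (c j) p))))"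
    unfolding eq prodinf_exp[OF summable_add[OF R Y]] suminf_add[OF R Y] ..
  then show ?thesis
    by (simp only: exp_add prodinf_exp[OF R] suminf_mult[OF S(2)])
qed

section \<open>Change of frame\<close>

lemma local_frame_scl:
  assumes "local_frame B E pr add scl U s" "p \<in> U"
  shows "scl a (scl b (s p)) = scl (a * b) (s p)"
  using assms by (auto simp: local_frame_def local_trivialization_def)

text \<open>The inverse is fibrewise division by \<open>c\<close>, continuous because
  \<open>c\<close> has no zeros.\<close>

lemma homeomorphic_map_fibrewise_mult:
  fixes U :: "'b::topological_space set" and c :: "'b \<Rightarrow> complex"
  assumes c: "continuous_on U c" and nz: "\<And>p. p \<in> U \<Longrightarrow> c p \<noteq> 0"
  shows "homeomorphic_map (prod_topology (top_of_set U) euclidean)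
    (prod_topology (top_of_set U) euclidean) (\<lambda>(p, z). (p, z * c p))"
proof -
  let ?X = "prod_topology (top_of_set U) (euclidean :: complex topology)"
  have X: "?X = top_of_set (U \<times> UNIV)"
    using prod_topology_subtopology_eu[of U "UNIV :: complex set"] by simp
  have c': "continuous_on (U \<times> UNIV) (\<lambda>x. c (fst x))"
    by (rule continuous_on_compose2[OF c]) (auto intro!: continuous_intros)
  have "continuous_map ?X ?X (\<lambda>(p, z). (p, z * c p))"
    unfolding X by (auto simp: case_prod_beta intro!: continuous_intros c')
  moreover have "continuous_map ?X ?X (\<lambda>(p, z). (p, z / c p))"
    unfolding X using nz by (auto simp: case_prod_beta intro!: continuous_intros c')
  ultimately have "homeomorphic_maps ?X ?X (\<lambda>(p, z). (p, z * c p)) (\<lambda>(p, z). (p, z / c p))"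
    using nz by (auto simp: homeomorphic_maps_def)
  then show ?thesis by (auto simp: homeomorphic_map_maps)
qed

text \<open>The trivialization by the rescaled section is the old one composed with fibrewise
  multiplication by \<open>c\<close>.\<close>

lemma local_frame_mult:
  assumes s: "local_frame B E pr add scl U s"
    and c: "continuous_on U c" and nz: "\<And>p. p \<in> U \<Longrightarrow> c p \<noteq> 0"
  shows "local_frame B E pr add scl U (\<lambda>p. scl (c p) (s p))"
proof -
  have U: "openin (top_of_set B) U"
    and h: "homeomorphic_map (prod_topology (top_of_set U) euclidean) (subtopology E (pr -` U))
      (\<lambda>(p, z). scl z (s p))"
    and fib: "\<And>p a b. p \<in> U \<Longrightarrow> pr (scl a (s p)) = p \<and>
        add (scl a (s p)) (scl b (s p)) = scl (a + b) (s p) \<and>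
        scl a (scl b (s p)) = scl (a * b) (s p)"
    using s by (auto simp: local_frame_def local_trivialization_def)
  have "homeomorphic_map (prod_topology (top_of_set U) euclidean) (subtopology E (pr -` U))
      ((\<lambda>(p, z). scl z (s p)) \<circ> (\<lambda>(p, z). (p, z * c p)))"
    by (rule homeomorphic_map_compose[OF homeomorphic_map_fibrewise_mult[OF c nz] h])
  then have "homeomorphic_map (prod_topology (top_of_set U) euclidean) (subtopology E (pr -` U))
      (\<lambda>(p, z). scl z (scl (c p) (s p)))"
    by (rule homeomorphic_map_eq) (auto simp: fib)
  moreover have "scl (c p) (s p) \<in> topspace E" if "p \<in> U" for p
  proof -
    \<comment> \<open>The rescaled section is the image of \<open>(p, c p)\<close> under the old
      trivialization, hence lies in the total space.\<close>
    have "(\<lambda>(p, z). scl z (s p)) (p, c p) \<in> topspace (subtopology E (pr -` U))"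
      using h that
      by (intro continuous_map_image_subset_topspace[THEN subsetD, OF homeomorphic_imp_continuous_map[OF h] imageI]) simp
    then show ?thesis by simp
  qed
  ultimately show ?thesis
    using U fib by (simp add: local_frame_def local_trivialization_def distrib_right mult.assoc)
qed

text \<open>The new transition function is \<open>c' g / c\<close>; the quotient is expressed as a
  product equation.\<close>

lemma transition_function_mult:
  assumes frame: "local_frame B E pr add scl U s" and W: "W \<subseteq> U"
    and g: "transition_function scl W s s' g"
    and eq: "\<And>p. p \<in> W \<Longrightarrow> c' p * g p = h p * c p"
  shows "transition_function scl W (\<lambda>p. scl (c p) (s p)) (\<lambda>p. scl (c' p) (s' p)) h"
  using g W eq local_frame_scl[OF frame] by (auto simp: transition_function_def)

lemma new_frame_transition:
  assumes frame: "local_frame B E pr add scl U (Z s k)" and W: "W \<subseteq> U"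
    and g: "transition_function scl W (Z s k) (Z s' k') g"
    and eq: "\<And>p. p \<in> W \<Longrightarrow>
      g p * exp (\<i> / (4 * of_real pi) * (f_rho xb xd s' k' p - f_rho xb xd s k p)
        - (pm s' (\<i> * of_real pi / 24) - pm s (\<i> * of_real pi / 24))) = h p"
  shows "transition_function scl W (new_frame scl Z xb xd s k) (new_frame scl Z xb xd s' k') h"
  unfolding new_frame_def
proof (rule transition_function_mult[OF frame W g])
  fix p assume "p \<in> W"
  show "exp (\<i> / (4 * of_real pi) * f_rho xb xd s' k' p - pm s' (\<i> * of_real pi / 24)) * g p =
      h p * exp (\<i> / (4 * of_real pi) * f_rho xb xd s k p - pm s (\<i> * of_real pi / 24))"
    unfolding eq[OF \<open>p \<in> W\<close>, symmetric]
    by (simp add: exp_diff right_diff_distrib field_simps flip: exp_add)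
qed

section \<open>The sectors not containing \<open>\<plusminus>\<L>\<^sub>\<infinity>\<close>\<close>

text \<open>The two jumps are the same logarithm with coefficients 1 and \<open>k\<close>, and
  \<open>2 pi i (v + k w) / l\<close> is the logarithm of \<open>X\<close> for the charge
  \<open>\<beta> + k\<delta>\<close>; the sign \<open>s\<close> moves into the charge.\<close>

lemma f_rho_step:
  assumes jumps: "has_jumps (\<lambda>J y. y + J) xb xd" and p: "p \<in> cover s k \<inter> cover s (k + 1)"
  shows "f_rho xb xd s (k + 1) p
    = f_rho xb xd s k p + logX (pm s (1, k)) p * Ln (1 - X_charge (pm s (1, k)) p)"
proof -
  obtain l v w where lvw: "p = (l, v, w)" by (cases p)
  have *: "xb s (k + 1) p = xb s k p + jump_b s k p" "xd s (k + 1) p = xd s k p + jump_d s k p"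
    using jumps p by (simp_all add: has_jumps_def)
  show ?thesis
    using * unfolding lvw f_rho_def prod.case jump_b_def jump_d_def logX_pm
    by (simp only:) (cases s; simp add: add_divide_distrib diff_divide_distrib algebra_simps)
qed

lemma f_rho_diff:
  assumes jumps: "has_jumps (\<lambda>J y. y + J) xb xd"
    and p: "p \<in> cover s k1" "p \<in> cover s k2" and "k1 \<le> k2"
  shows "f_rho xb xd s k2 p - f_rho xb xd s k1 p
    = (\<Sum>k\<in>{k1..<k2}. logX (pm s (1, k)) p * Ln (1 - X_charge (pm s (1, k)) p))"
  using \<open>k1 \<le> k2\<close> p(2)
proof (induction k2 rule: int_ge_induct)
  case base
  then show ?case by simp
next
  case (step k)
  have mem: "p \<in> cover s k"
    using cover_between[OF p(1) step.prems] step.hyps by simp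
  have "{k1..<k + 1} = insert k {k1..<k}" using step.hyps by auto
  then show ?case
    using step.IH[OF mem] f_rho_step[OF jumps, of p s k] mem step.prems by simp
qed

text \<open>Since \<open>i / (4 pi)\<close> is minus one half of \<open>1 / (2 pi i)\<close>, the
  extra factor halves the product \<open>logX * Ln (1 - X)\<close> in the exponent of
  \<open>Xi\<close>.\<close>

lemma Xi_eq_Rogers_factor:
  assumes "Re (logX (pm s (1, k)) p) < 0"
  shows "Xi s k p * exp (\<i> / (4 * of_real pi) * (logX (pm s (1, k)) p * Ln (1 - X_charge (pm s (1, k)) p)))
    = Rogers_factor (1, k) (pm s (1, k)) p"
  unfolding Xi_def Rogers_factor_def d_lambda_Li2_eq[OF assms] Rogers_def exp_add[symmetric]
  by (rule arg_cong[where f = exp]) (simp add: BPS_def field_simps)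

lemma g_new_eq:
  assumes jumps: "has_jumps (\<lambda>J y. y + J) xb xd"
    and p: "p \<in> cover s k1" "p \<in> cover s k2" and "k1 \<le> k2"
  shows "g_sec s k1 k2 p * exp (\<i> / (4 * of_real pi) * (f_rho xb xd s k2 p - f_rho xb xd s k1 p))
    = g_new s k1 k2 p"
  unfolding g_sec_def g_new_def f_rho_diff[OF assms] sum_distrib_left exp_sum[OF finite_atLeastLessThan_int]
    prod.distrib[symmetric]
  by (intro prod.cong refl Xi_eq_Rogers_factor cover_Re_logX_neg[OF p]) auto

section \<open>The sectors containing \<open>\<plusminus>\<L>\<^sub>\<infinity>\<close>\<close>

lemma prod_from_Rogers:
  fixes C :: complex
  assumes "Re (logX (pm s (0, 1)) (l, v, w)) < 0"
    and neg: "\<And>j. Re (logX (pm s (n, m + int j)) (l, v, w)) < 0"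
  defines "y \<equiv> \<lambda>k. Ln (1 - X_charge (pm s (n, k)) (l, v, w))"
  shows "prod_from m (\<lambda>k. exp (C * d_lambda_Li2 (pm s (n, k)) (l, v, w)))
    = prod_from m (\<lambda>k. exp (C * Rogers (pm s (n, k)) (l, v, w)))
      * exp (C / 2 * (pm s (2 * of_real pi * \<i> / l)
        * (v * (of_int n * sum_from m y) + w * sum_from m (\<lambda>k. of_int k * y k))))"
  unfolding prod_from_def y_def
  using prodinf_Rogers[where C = C, OF neg X_charge_series_summable(3)[OF assms(1,2)]
      sum_from_linear_combination(1)[OF assms(1,2)]]
  unfolding sum_from_linear_combination(2)[OF assms(1,2)] .

text \<open>Under \<open>k\<close> to \<open>- k\<close> the strict upper bound becomes the lower
  bound \<open>- k + 1\<close>, the starting index of the second sums in the jumps.\<close>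

lemma prod_below_eq_prod_from: "prod_below k F = prod_from (- k + 1) (\<lambda>k. F (- k))"
  by (simp add: prod_below_def prod_from_def algebra_simps)

lemma prod_from_cong: "(\<And>k. m \<le> k \<Longrightarrow> F k = G k) \<Longrightarrow> prod_from m F = prod_from m G"
  by (simp add: prod_from_def)

fun opposite :: "sign \<Rightarrow> sign" where
  "opposite Plus = Minus"
| "opposite Minus = Plus"

lemma pm_opposite: "pm (opposite s) (1 :: int, k :: int) = pm s (- 1, - k)"
  by (cases s) simp_all

text \<open>One computation serves both signs of \<open>L_inf\<close>. Each product leaves the
  exponential of its \<open>logX * Ln (1 - X)\<close> series; the weights \<open>e / 2\<close>,
  \<open>e / 2\<close> and \<open>- e\<close> for the charges along \<open>\<beta>\<close>,
  \<open>- \<beta>\<close> and 0 match the jump of \<open>f\<close> multiplied by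
  \<open>i / (4 pi) = - e / 2\<close>.\<close>

lemma infinite_product_Rogers:
  assumes p: "p = (l, v, w)"
    and delta: "Re (logX (pm s (0, 1)) p) < 0"
    and pos: "\<And>k. a \<le> k \<Longrightarrow> Re (logX (pm s (1, k)) p) < 0"
    and neg: "\<And>k. - b < k \<Longrightarrow> Re (logX (pm s (- 1, k)) p) < 0"
  defines "y \<equiv> \<lambda>n k. Ln (1 - X_charge (pm s (n, k)) p)"
  shows "prod_from a (\<lambda>k. Xi s k p) * prod_below b (\<lambda>k. Xi (opposite s) k p)
      * prod_from 1 (\<lambda>k. Xi_inf s k p)
      * exp (\<i> / (4 * of_real pi) * (pm s (2 * of_real pi * \<i> / l) *
          (v * (sum_from a (y 1) - sum_from (- b + 1) (y (- 1)))
          + w * (sum_from a (\<lambda>k. of_int k * y 1 k) + sum_from (- b + 1) (\<lambda>k. of_int k * y (- 1) k)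
            - sum_from 1 (\<lambda>k. 2 * of_int k * y 0 k)))))
    = prod_from a (\<lambda>k. Rogers_factor (1, k) (pm s (1, k)) p)
      * prod_below b (\<lambda>k. Rogers_factor (1, k) (pm (opposite s) (1, k)) p)
      * prod_from 1 (\<lambda>k. Rogers_factor (0, k) (pm s (0, k)) p)"
proof -
  define c where "c = pm s (2 * of_real pi * \<i> / l)"
  define e where "e = 1 / (2 * of_real pi * \<i>)"
  have e: "\<i> / (4 * of_real pi) = - (e / 2)" by (simp add: e_def field_simps)
  have delta_k: "Re (logX (pm s (0, k)) p) < 0" if "1 \<le> k" for k
  proof -
    have "logX (pm s (0, k)) p = of_int k * logX (pm s (0, 1)) p" by (simp add: p logX_pm)
    then show ?thesis using delta that by (simp add: mult_pos_neg)
  qed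
  have A: "prod_from a (\<lambda>k. Xi s k p) = prod_from a (\<lambda>k. Rogers_factor (1, k) (pm s (1, k)) p)
      * exp (e / 2 * (c * (v * sum_from a (y 1) + w * sum_from a (\<lambda>k. of_int k * y 1 k))))"
    using prod_from_Rogers[of s l v w 1 a e] delta pos
    by (simp add: Xi_def Rogers_factor_def BPS_def p y_def c_def e_def)
  \<comment> \<open>After reflecting the index, the charges are \<open>- \<beta> + k\<delta>\<close>
    up to the sign \<open>s\<close>, whence the minus sign at \<open>v\<close>.\<close>
  have B: "prod_below b (\<lambda>k. Xi (opposite s) k p)
      = prod_below b (\<lambda>k. Rogers_factor (1, k) (pm (opposite s) (1, k)) p)
      * exp (e / 2 * (c * (- v * sum_from (- b + 1) (y (- 1)) + w * sum_from (- b + 1) (\<lambda>k. of_int k * y (- 1) k))))"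
    using prod_from_Rogers[of s l v w "- 1" "- b + 1" e] delta neg
    by (simp add: prod_below_eq_prod_from pm_opposite Xi_def Rogers_factor_def BPS_def p y_def c_def e_def)
  have D: "prod_from 1 (\<lambda>k. Xi_inf s k p)
      = prod_from 1 (\<lambda>k. Rogers_factor (0, k) (pm s (0, k)) p)
      * exp (- e * (c * (w * sum_from 1 (\<lambda>k. of_int k * y 0 k))))"
  proof -
    have "prod_from 1 (\<lambda>k. Xi_inf s k p) = prod_from 1 (\<lambda>k. exp (- (2 * e) * d_lambda_Li2 (pm s (0, k)) (l, v, w)))"
      by (simp add: Xi_inf_def p e_def)
    moreover have "prod_from 1 (\<lambda>k. Rogers_factor (0, k) (pm s (0, k)) p)
        = prod_from 1 (\<lambda>k. exp (- (2 * e) * Rogers (pm s (0, k)) (l, v, w)))"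
      by (intro prod_from_cong) (simp add: Rogers_factor_def BPS_def p e_def)
    ultimately show ?thesis
      using prod_from_Rogers[of s l v w 0 1 "- (2 * e)"] delta delta_k
      by (simp add: p y_def c_def)
  qed
  have two: "sum_from 1 (\<lambda>k. 2 * of_int k * y 0 k) = 2 * sum_from 1 (\<lambda>k. of_int k * y 0 k)"
  proof -
    have "summable (\<lambda>j. y 0 (1 + int j) + of_nat j * y 0 (1 + int j))"
      unfolding y_def by (intro summable_add X_charge_series_summable delta delta_k) auto
    then have "summable (\<lambda>j. of_int (1 + int j) * y 0 (1 + int j))"
      by (simp add: distrib_right)
    from suminf_mult[OF this, of 2] show ?thesis
      by (simp only: sum_from_def mult.assoc)
  qed
  \<comment> \<open>The leftover exponents of the three products and of the jump factor sum to
    zero.\<close>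
  have cancel: "(P * exp a') * (Q * exp b') * (R * exp d') * exp f' = P * Q * R"
    if "a' + b' + d' + f' = 0" for P Q R a' b' d' f' :: complex
  proof -
    have "(P * exp a') * (Q * exp b') * (R * exp d') * exp f' = P * Q * R * exp (a' + b' + d' + f')"
      by (simp only: exp_add mult_ac)
    then show ?thesis by (simp only: that exp_zero mult_1_right)
  qed
  show ?thesis
    unfolding A B D e c_def[symmetric] two by (rule cancel) (simp add: algebra_simps)
qed

lemma f_rho_diff_overlap:
  assumes "xb s' k' (l, v, w) = xb s k (l, v, w) + J" "xd s' k' (l, v, w) = xd s k (l, v, w) + J'"
  shows "f_rho xb xd s' k' (l, v, w) - f_rho xb xd s k (l, v, w) = 2 * of_real pi * \<i> / l * (v * J + w * J')"
  unfolding f_rho_def prod.case assms by (simp add: add_divide_distrib algebra_simps)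

lemma g_new_inf_eq:
  assumes jumps: "has_jumps (\<lambda>J y. y + J) xb xd" and p: "p \<in> overlap_inf Plus k1 k2"
  shows "g_inf k1 k2 p * exp (\<i> / (4 * of_real pi) * (f_rho xb xd Minus k2 p - f_rho xb xd Plus k1 p)
      - (pm Minus (\<i> * of_real pi / 24) - pm Plus (\<i> * of_real pi / 24))) = g_new_inf k1 k2 p"
proof -
  obtain l v w where lvw: "p = (l, v, w)" by (cases p)
  have f: "f_rho xb xd Minus k2 p - f_rho xb xd Plus k1 p
      = 2 * of_real pi * \<i> / l * (v * jump_b_inf k1 k2 p + w * jump_d_inf k1 k2 p)"
    using jumps p unfolding has_jumps_def lvw by (intro f_rho_diff_overlap) auto
  note I = infinite_product_Rogers[OF lvw, of Plus k1 k2, OF overlap_inf_Re_logX_neg_delta[OF p]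
      overlap_inf_Re_logX_neg(1)[OF p] overlap_inf_Re_logX_neg(2)[OF p]]
  have "g_inf k1 k2 p * exp (x - (pm Minus (\<i> * of_real pi / 24) - pm Plus (\<i> * of_real pi / 24)))
      = prod_from k1 (\<lambda>k. Xi Plus k p) * prod_below k2 (\<lambda>k. Xi Minus k p)
        * prod_from 1 (\<lambda>k. Xi_inf Plus k p) * exp x" for x
  proof -
    \<comment> \<open>The constants of the two frames contribute \<open>i pi / 12\<close>, which
      removes the constant in \<open>g_inf\<close>.\<close>
    have "exp (- (of_real pi * \<i> / 12)) * exp (x - (pm Minus (\<i> * of_real pi / 24) - pm Plus (\<i> * of_real pi / 24)))
        = exp x"
      unfolding exp_add[symmetric] by (rule arg_cong[where f = exp]) simp
    then show ?thesis by (simp only: g_inf_def mult_ac)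
  qed
  then show ?thesis
    unfolding f jump_b_inf_def jump_d_inf_def g_new_inf_def using I by simp
qed

lemma g_new_minf_eq:
  assumes jumps: "has_jumps (\<lambda>J y. y + J) xb xd" and p: "p \<in> overlap_inf Minus k1 k2"
  shows "g_minf k2 k1 p * exp (\<i> / (4 * of_real pi) * (f_rho xb xd Plus k1 p - f_rho xb xd Minus k2 p)
      - (pm Plus (\<i> * of_real pi / 24) - pm Minus (\<i> * of_real pi / 24))) = g_new_minf k2 k1 p"
proof -
  obtain l v w where lvw: "p = (l, v, w)" by (cases p)
  have f: "f_rho xb xd Plus k1 p - f_rho xb xd Minus k2 p
      = 2 * of_real pi * \<i> / l * (v * jump_b_minf k2 k1 p + w * jump_d_minf k2 k1 p)"
    using jumps p unfolding has_jumps_def lvw by (intro f_rho_diff_overlap) auto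
  \<comment> \<open>For sign \<open>Minus\<close> the increasing family starts at \<open>k2\<close>,
    so the two indices exchange roles.\<close>
  note I = infinite_product_Rogers[OF lvw, of Minus k2 k1, OF overlap_inf_Re_logX_neg_delta[OF p]
      overlap_inf_Re_logX_neg(1)[OF p] overlap_inf_Re_logX_neg(2)[OF p]]
  have "g_minf k2 k1 p * exp (x - (pm Plus (\<i> * of_real pi / 24) - pm Minus (\<i> * of_real pi / 24)))
      = prod_from k2 (\<lambda>k. Xi Minus k p) * prod_below k1 (\<lambda>k. Xi Plus k p)
        * prod_from 1 (\<lambda>k. Xi_inf Minus k p) * exp x" for x
  proof -
    have "exp (of_real pi * \<i> / 12) * exp (x - (pm Plus (\<i> * of_real pi / 24) - pm Minus (\<i> * of_real pi / 24)))
        = exp x"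
      unfolding exp_add[symmetric] by (rule arg_cong[where f = exp]) simp
    then show ?thesis by (simp only: g_minf_def mult_ac)
  qed
  \<comment> \<open>The jumps across the ray \<open>- L_inf\<close> carry the opposite overall sign,
    matching \<open>pm Minus\<close> in the prefactor of the general identity.\<close>
  moreover have "c * (v * (- A + B) + w * (- A' - B' + D)) = - c * (v * (A - B) + w * (A' + B' - D))"
    for c A B A' B' D :: complex
    by (simp add: algebra_simps)
  ultimately show ?thesis
    unfolding f jump_b_minf_def jump_d_minf_def g_new_minf_def using I by simp
qed

section \<open>The rescaled frames and their transition functions\<close>

theorem proposition4p19:
  fixes E :: "'e topology"
    and pr :: "'e \<Rightarrow> point"
    and add :: "'e \<Rightarrow> 'e \<Rightarrow> 'e"
    and scl :: "complex \<Rightarrow> 'e \<Rightarrow> 'e"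
    and Z :: "sign \<Rightarrow> int \<Rightarrow> point \<Rightarrow> 'e"
    and Xb Xd xb xd :: "sign \<Rightarrow> int \<Rightarrow> point \<Rightarrow> complex"
  assumes line_bundle: "complex_line_bundle base_space E pr add scl"
    and frames: "\<And>s k. local_frame base_space E pr add scl (cover s k) (Z s k)"
    and transitions: "has_original_transition_functions scl Z"
    and RH: "solves_Bridgeland_RH Xb Xd"
    and logs: "logarithms_of_RH_solution Xb Xd xb xd"
  shows "(\<forall>s k. continuous_on (cover s k) (f_rho xb xd s k)
            \<longrightarrow> local_frame base_space E pr add scl (cover s k) (new_frame scl Z xb xd s k))
    \<and> (\<forall>s k1 k2. k1 < k2 \<longrightarrow>
         transition_function scl (cover s k1 \<inter> cover s k2)
           (new_frame scl Z xb xd s k1) (new_frame scl Z xb xd s k2) (g_new s k1 k2))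
    \<and> (\<forall>k1 k2.
         transition_function scl (overlap_inf Plus k1 k2)
           (new_frame scl Z xb xd Plus k1) (new_frame scl Z xb xd Minus k2) (g_new_inf k1 k2))
    \<and> (\<forall>k1 k2.
         transition_function scl (overlap_inf Minus k1 k2)
           (new_frame scl Z xb xd Minus k2) (new_frame scl Z xb xd Plus k1) (g_new_minf k2 k1))"
proof -
  have jumps: "has_jumps (\<lambda>J y. y + J) xb xd"
    using logs by (simp add: logarithms_of_RH_solution_def)
  have g: "\<And>s k1 k2. k1 < k2 \<Longrightarrow>
      transition_function scl (cover s k1 \<inter> cover s k2) (Z s k1) (Z s k2) (g_sec s k1 k2)"
    "\<And>k1 k2. transition_function scl (overlap_inf Plus k1 k2) (Z Plus k1) (Z Minus k2) (g_inf k1 k2)"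
    "\<And>k1 k2. transition_function scl (overlap_inf Minus k1 k2) (Z Minus k2) (Z Plus k1) (g_minf k2 k1)"
    using transitions by (auto simp: has_original_transition_functions_def)
  have sub: "overlap_inf s k1 k2 \<subseteq> cover Plus k1" "overlap_inf s k1 k2 \<subseteq> cover Minus k2" for s k1 k2
    by (auto simp: overlap_inf_def)
  show ?thesis
  proof (intro conjI allI impI)
    fix s k assume "continuous_on (cover s k) (f_rho xb xd s k)"
    then show "local_frame base_space E pr add scl (cover s k) (new_frame scl Z xb xd s k)"
      unfolding new_frame_def
      \<comment> \<open>The scaling factor is an exponential, hence has no zeros.\<close>
      by (intro local_frame_mult[OF frames] continuous_intros) simp_all
  next
    fix s and k1 k2 :: int assume "k1 < k2"
    show "transition_function scl (cover s k1 \<inter> cover s k2)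
        (new_frame scl Z xb xd s k1) (new_frame scl Z xb xd s k2) (g_new s k1 k2)"
      \<comment> \<open>Both frames carry the same constant \<open>pm s (i pi / 24)\<close>, which
        cancels.\<close>
      by (rule new_frame_transition[OF frames Int_lower1 g(1)[OF \<open>k1 < k2\<close>]])
         (use g_new_eq[OF jumps] \<open>k1 < k2\<close> in simp)
  next
    fix k1 k2
    show "transition_function scl (overlap_inf Plus k1 k2)
        (new_frame scl Z xb xd Plus k1) (new_frame scl Z xb xd Minus k2) (g_new_inf k1 k2)"
      by (rule new_frame_transition[OF frames sub(1) g(2) g_new_inf_eq[OF jumps]])
  next
    fix k1 k2
    show "transition_function scl (overlap_inf Minus k1 k2)
        (new_frame scl Z xb xd Minus k2) (new_frame scl Z xb xd Plus k1) (g_new_minf k2 k1)"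
      by (rule new_frame_transition[OF frames sub(2) g(3) g_new_minf_eq[OF jumps]])
  qed
qed

end
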